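(* Let $m \ge n \ge 3$ be integers, let $\mathcal{V} \subseteq C[-1,1]$ be an $n$-dimensional Chebyshev space containing the constant functions, with basis $(v_1,\ldots,v_n)$, and let $-1 \le x^{(1)} < \cdots < x^{(m)} \le 1$. Set $x^{(0)}=-1$, $x^{(m+1)}=1$, and let $K$ be the set of those $k \in \{1,\ldots,m+1\}$ with $x^{(k-1)} < x^{(k)}$. Let $M \in \mathbb{R}^{n\times m}$ have entries $M_{j,i} = v_j(x^{(i)})$, and for $x \in [-1,1]$ let $b(x) = [v_1(x);\ldots;v_n(x)] \in \mathbb{R}^n$. For each $k \in K$, choose an arbitrary point $z^{(k)} \in (x^{(k-1)},x^{(k)})$. Then: (i) For each $k \in K$ there exists an index set $S_k \subseteq \{1,\ldots,m\}$ of size $|S_k| = n$ such that the vector $a^{(k)} \in \mathbb{R}^m$ supported on $S_k$ and satisfying $a^{(k)}_{S_k} = M_{S_k}^{-1} b(z^{(k)})$ is a solution to $$\underset{a \in \mathbb{R}^m}{\rm minimize}\; \|a\|_1 \qquad \text{subject to } Ma = b(z^{(k)}).$$ (ii) For any choice of index sets $S_k$, $k \in K$, as in (i), define functions $a^\sharp_1,\ldots,a^\sharp_m$ on $[-1,1]$ as follows: for $k \in K$ and $x \in (x^{(k-1)},x^{(k)})$, $$a_i^\sharp(x) = \begin{cases} \sum_{j=1}^n [M_{S_k}^{-1}]_{i,j}\, v_j(x) & \text{if } i \in S_k,\\ 0 & \text{if } i \notin S_k,\end{cases}$$ the same formula with $k=1$ being used at $x=-1$ if $x^{(1)} > -1$,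 and the same formula with $k=m+1$ being used at $x = 1$ if $x^{(m)} < 1$; and $a^\sharp_i(x^{(\ell)}) = 1$ if $i=\ell$, $a_i^\sharp(x^{(\ell)}) = 0$ if $i \ne \ell$, for $\ell \in \{1,\ldots,m\}$. Then the functions $a^\sharp_1,\ldots,a^\sharp_m$ are continuous on $[-1,1]$. (iii) With $a_1^\sharp,\ldots,a_m^\sharp$ as in (ii), the linear map $\Delta^\sharp : \mathbb{R}^m \to C[-1,1]$, $\Delta^\sharp(y) = \sum_{i=1}^m y_i a_i^\sharp$, is an optimal recovery map for every $\varepsilon \ge 0$, that is, $${\rm wce}_{\mathcal{K}_{\mathcal{V},\varepsilon}}(\Delta^\sharp) \le {\rm wce}_{\mathcal{K}_{\mathcal{V},\varepsilon}}(\Delta) \qquad \text{for every map } \Delta: \mathbb{R}^m \to C[-1,1] \text{ (linear or not)}.$$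
   Context: $C[-1,1]$ is the space of real-valued continuous functions on $[-1,1]$ with the uniform norm $\|f\|_{C[-1,1]} = \max_{x\in[-1,1]}|f(x)|$. An $n$-dimensional subspace $\mathcal{V}$ of $C[-1,1]$ is a Chebyshev space if, for any distinct points $\xi^{(1)},\ldots,\xi^{(n)} \in [-1,1]$ and any values $\gamma_1,\ldots,\gamma_n\in\mathbb{R}$, there is a unique $v \in \mathcal{V}$ with $v(\xi^{(i)}) = \gamma_i$ for all $i\in\{1,\ldots,n\}$. For $S \subseteq \{1,\ldots,m\}$ with $|S| = n$, $a_S \in \mathbb{R}^n$ denotes the subvector of $a\in\mathbb{R}^m$ with entries indexed by $S$, and $M_S \in \mathbb{R}^{n\times n}$ the submatrix of $M$ with columns indexed by $S$ (invertible when $\mathcal{V}$ is a Chebyshev space and the points are distinct); the rows of $M_S^{-1}$ are indexed by $S$. A vector $a$ is supported on $S$ if $a_i = 0$ for $i \notin S$. $\|a\|_1 = \sum_i |a_i|$. For $\varepsilon \ge 0$, $\mathcal{K}_{\mathcal{V},\varepsilon} = \{ f \in C[-1,1] : {\rm dist}_{C[-1,1]}(f,\mathcal{V}) \le \varepsilon\}$, where ${\rm dist}_{C[-1,1]}(f,\mathcal{V}) = \inf_{v \in \mathcal{V}}\|f-v\|_{C[-1,1]}$. For a map $\Delta:\mathbb{R}^m\to C[-1,1]$ and a set $\mathcal{K}\subseteq C[-1,1]$, the worst-case error is $${\rm wce}_{\mathcal{K}}(\Delta) = \sup_{f \in \mathcal{K}} \big\| f - \Delta([f(x^{(1)});\ldots;f(x^{(m)})])\big\|_{C[-1,1]}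 \in [0,+\infty].$$ *)

theory Defs
  imports "HOL-Analysis.Analysis"
begin

section \<open>The interval [-1,1] as a compact, linearly ordered metric space\<close>

typedef seg = "{-1..1::real}"
  morphisms real_of_seg seg_of_real
  by (rule exI[of _ 0]) simp

instantiation seg :: metric_space
begin

definition dist_seg :: "seg \<Rightarrow> seg \<Rightarrow> real" where
  "dist_seg s t = dist (real_of_seg s) (real_of_seg t)"

definition uniformity_seg :: "(seg \<times> seg) filter" where
  "uniformity_seg = (INF e\<in>{0<..}. principal {(s, t). dist s t < e})"

definition open_seg :: "seg set \<Rightarrow> bool" where
  "open_seg U = (\<forall>s\<in>U. \<forall>\<^sub>F (s', t) in uniformity. s' = s \<longrightarrow> t \<in> U)"

instance
proof
  fix s t u :: seg
  show "dist s t = 0 \<longleftrightarrow> s = t"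
    by (simp add: dist_seg_def real_of_seg_inject)
  show "dist s t \<le> dist s u + dist t u"
    unfolding dist_seg_def by (rule dist_triangle2)
qed (rule open_seg_def uniformity_seg_def)+

end

instantiation seg :: linorder
begin

definition less_eq_seg :: "seg \<Rightarrow> seg \<Rightarrow> bool" where
  "less_eq_seg s t \<longleftrightarrow> real_of_seg s \<le> real_of_seg t"

definition less_seg :: "seg \<Rightarrow> seg \<Rightarrow> bool" where
  "less_seg s t \<longleftrightarrow> real_of_seg s < real_of_seg t"

instance
  by standard (auto simp: less_eq_seg_def less_seg_def real_of_seg_inject)

end

instantiation seg :: "{order_bot, order_top}"
begin

definition bot_seg :: seg where "bot_seg = seg_of_real (-1)"

definition top_seg :: seg where "top_seg = seg_of_real 1"

instance
proof
  fix s :: seg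
  have "-1 \<le> real_of_seg s" "real_of_seg s \<le> 1"
    using real_of_seg[of s] by auto
  then show "bot \<le> s" "s \<le> top"
    by (auto simp: less_eq_seg_def bot_seg_def top_seg_def seg_of_real_inverse)
qed

end

lemma continuous_on_real_of_seg: "continuous_on UNIV real_of_seg"
  unfolding continuous_on_iff dist_seg_def by auto

lemma continuous_on_seg_of_real: "continuous_on {-1..1} seg_of_real"
  unfolding continuous_on_iff dist_seg_def by (auto simp: seg_of_real_inverse)

lemma continuous_on_seg_iff:
  fixes f :: "seg \<Rightarrow> 'a::topological_space"
  shows "continuous_on UNIV f \<longleftrightarrow> continuous_on {-1..1} (\<lambda>t. f (seg_of_real t))"
proof
  assume "continuous_on UNIV f"
  then show "continuous_on {-1..1} (\<lambda>t. f (seg_of_real t))"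
    by (rule continuous_on_compose2[OF _ continuous_on_seg_of_real]) simp
next
  assume "continuous_on {-1..1} (\<lambda>t. f (seg_of_real t))"
  then have "continuous_on UNIV (\<lambda>s. f (seg_of_real (real_of_seg s)))"
    by (rule continuous_on_compose2[OF _ continuous_on_real_of_seg]) (use real_of_seg in auto)
  then show "continuous_on UNIV f"
    by (simp add: real_of_seg_inverse)
qed

lemma compact_UNIV_seg: "compact (UNIV :: seg set)"
proof -
  have "compact (seg_of_real ` {-1..1})"
    by (rule compact_continuous_image[OF continuous_on_seg_of_real]) simp
  moreover have "seg_of_real ` {-1..1} = UNIV"
    using real_of_seg real_of_seg_inverse by (metis UNIV_eq_I image_eqI)
  ultimately show ?thesis by simp
qed

text \<open>
  By compactness the library's space of bounded continuous functions on \<^typ>\<open>seg\<close>, with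
  its supremum norm, is C[-1,1].
\<close>

lemma bcontfun_seg_iff:
  fixes f :: "seg \<Rightarrow> real"
  shows "f \<in> bcontfun \<longleftrightarrow> continuous_on UNIV f"
  using compact_imp_bounded[OF compact_continuous_image[OF _ compact_UNIV_seg]]
  by (auto simp: bcontfun_def)

type_synonym cspace = "seg \<Rightarrow>\<^sub>C real"


section \<open>Chebyshev spaces, approximability model, worst-case error\<close>

definition chebyshev_space :: "nat \<Rightarrow> cspace set \<Rightarrow> bool" where
  "chebyshev_space n V \<longleftrightarrow> subspace V \<and> dim V = n \<and>
     (\<forall>\<xi> :: nat \<Rightarrow> seg. inj_on \<xi> {1..n} \<longrightarrow>
       (\<forall>\<gamma> :: nat \<Rightarrow> real. \<exists>!v. v \<in> V \<and> (\<forall>i\<in>{1..n}. apply_bcontfun v (\<xi> i) = \<gamma> i)))"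

definition approx_model :: "cspace set \<Rightarrow> real \<Rightarrow> cspace set" where
  "approx_model V \<epsilon> = {f. infdist f V \<le> \<epsilon>}"

text \<open>
  Vectors in the space of real m-tuples are functions \<^typ>\<open>nat \<Rightarrow> real\<close> of which only the
  entries with index in \<open>{1..m}\<close> matter. The observation vector is normalised by \<^const>\<open>restrict\<close>,
  so a recovery map has access to the m samples only.
\<close>

definition wce :: "nat \<Rightarrow> (nat \<Rightarrow> seg) \<Rightarrow> cspace set \<Rightarrow> ((nat \<Rightarrow> real) \<Rightarrow> cspace) \<Rightarrow> ennreal" where
  "wce m x F \<Delta> = (SUP f\<in>F. ennreal (norm (f - \<Delta> (\<lambda>i\<in>{1..m}. apply_bcontfun f (x i)))))"


section \<open>The matrix M, its square submatrices, and the minimization problem\<close>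

definition colloc :: "(nat \<Rightarrow> cspace) \<Rightarrow> (nat \<Rightarrow> seg) \<Rightarrow> nat \<Rightarrow> nat \<Rightarrow> real" where
  "colloc v x j i = apply_bcontfun (v j) (x i)"

text \<open>
  The inverse of the submatrix of \<open>M\<close> with rows \<open>{1..n}\<close> and columns \<open>S\<close>; its rows are
  indexed by \<open>S\<close> and its columns by \<open>{1..n}\<close>. The last conjunct (zero outside the index range)
  makes the two-sided inverse unique as a function on \<^typ>\<open>nat\<close>; the value is meaningful only if
  the submatrix is invertible.
\<close>

definition sub_inverse :: "nat \<Rightarrow> (nat \<Rightarrow> nat \<Rightarrow> real) \<Rightarrow> nat set \<Rightarrow> nat \<Rightarrow> nat \<Rightarrow> real" where
  "sub_inverse n M S = (THE N.
     (\<forall>j\<in>{1..n}. \<forall>j'\<in>{1..n}. (\<Sum>i\<in>S. M j i * N i j') = (if j = j' then 1 else 0)) \<and>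
     (\<forall>i\<in>S. \<forall>i'\<in>S. (\<Sum>j=1..n. N i j * M j i') = (if i = i' then 1 else 0)) \<and>
     (\<forall>i j. i \<notin> S \<or> j \<notin> {1..n} \<longrightarrow> N i j = 0))"

definition coeff_vec :: "nat \<Rightarrow> (nat \<Rightarrow> cspace) \<Rightarrow> (nat \<Rightarrow> seg) \<Rightarrow> nat set \<Rightarrow> seg \<Rightarrow> nat \<Rightarrow> real" where
  "coeff_vec n v x S t i =
     (if i \<in> S then \<Sum>j=1..n. sub_inverse n (colloc v x) S i j * apply_bcontfun (v j) t else 0)"

definition l1_feasible :: "nat \<Rightarrow> nat \<Rightarrow> (nat \<Rightarrow> nat \<Rightarrow> real) \<Rightarrow> (nat \<Rightarrow> real) \<Rightarrow> (nat \<Rightarrow> real) \<Rightarrow> bool" where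
  "l1_feasible m n M b a \<longleftrightarrow> (\<forall>j\<in>{1..n}. (\<Sum>i=1..m. M j i * a i) = b j)"

definition l1_solution :: "nat \<Rightarrow> nat \<Rightarrow> (nat \<Rightarrow> nat \<Rightarrow> real) \<Rightarrow> (nat \<Rightarrow> real) \<Rightarrow> (nat \<Rightarrow> real) \<Rightarrow> bool" where
  "l1_solution m n M b a \<longleftrightarrow> l1_feasible m n M b a \<and>
     (\<forall>a'. l1_feasible m n M b a' \<longrightarrow> (\<Sum>i=1..m. \<bar>a i\<bar>) \<le> (\<Sum>i=1..m. \<bar>a' i\<bar>))"

definition admissible_set ::
  "nat \<Rightarrow> nat \<Rightarrow> (nat \<Rightarrow> cspace) \<Rightarrow> (nat \<Rightarrow> seg) \<Rightarrow> seg \<Rightarrow> nat set \<Rightarrow> bool" where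
  "admissible_set m n v x t S \<longleftrightarrow> S \<subseteq> {1..m} \<and> card S = n \<and>
     l1_solution m n (colloc v x) (\<lambda>j. apply_bcontfun (v j) t) (coeff_vec n v x S t)"


section \<open>The recovery functions and the recovery map\<close>

definition gaps :: "nat \<Rightarrow> (nat \<Rightarrow> seg) \<Rightarrow> nat set" where
  "gaps m x = {k \<in> {1..m + 1}. x (k - 1) < x k}"

text \<open>
  The index of the gap whose formula is used at a point \<open>t\<close> that is not one of
  \<open>x 1, \<dots>, x m\<close>; here \<open>bot\<close> is -1 and \<open>top\<close> is 1. For such \<open>t\<close> exactly one \<open>k\<close> qualifies.
\<close>

definition gap_index :: "nat \<Rightarrow> (nat \<Rightarrow> seg) \<Rightarrow> seg \<Rightarrow> nat" where
  "gap_index m x t = (THE k. k \<in> gaps m x \<and>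
     (t \<in> {x (k - 1)<..<x k} \<or> k = 1 \<and> t = bot \<or> k = m + 1 \<and> t = top))"

definition a_sharp ::
  "nat \<Rightarrow> nat \<Rightarrow> (nat \<Rightarrow> cspace) \<Rightarrow> (nat \<Rightarrow> seg) \<Rightarrow> (nat \<Rightarrow> nat set) \<Rightarrow> nat \<Rightarrow> seg \<Rightarrow> real" where
  "a_sharp m n v x S i t =
     (if t \<in> x ` {1..m} then (if t = x i then 1 else 0)
      else coeff_vec n v x (S (gap_index m x t)) t i)"

text \<open>
  \<^const>\<open>Bcontfun\<close> turns a continuous function into an element of \<^typ>\<open>cspace\<close>; it is
  meaningful here once the functions \<^const>\<open>a_sharp\<close> are known to be continuous.
\<close>

definition recovery_map ::
  "nat \<Rightarrow> nat \<Rightarrow> (nat \<Rightarrow> cspace) \<Rightarrow> (nat \<Rightarrow> seg) \<Rightarrow> (nat \<Rightarrow> nat set) \<Rightarrow> (nat \<Rightarrow> real) \<Rightarrow> cspace" where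
  "recovery_map m n v x S y = (\<Sum>i=1..m. y i *\<^sub>R Bcontfun (a_sharp m n v x S i))"

end

(*
For t off the nodes, the minimal l1 norm among the vectors a with Ma = b(t) is attained at a basic
solution, whose entries are the values at t of the Lagrange functions of n nodes S. A Lagrange
function vanishes only at the other nodes of S, so all entries are nonzero, their signs are
constant between consecutive nodes, and optimality is equivalent to a bound |c(x_j)| <= 1 for the
element c of V interpolating these signs on S. Hence one S serves a whole gap. As V contains the
constants and n >= 3, some entry is negative, which forces the nodes adjacent to t into S; this
gives the continuity at the nodes. With L(t) the minimal norm, the pointwise error of the recovery
map is at most eps (1 + L(t)). Conversely, if G has norm at most 1, agrees with c at the nodes and
is -1 at t, then both signs of eps (c - G) lie in the model set and have vanishing data, so every
recovery map has error at least eps (1 + L(t)).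
*)

theory Submission
  imports Defs
begin

section \<open>Preliminaries on the segment\<close>

lemma sum_bcontfun_apply:
  fixes f :: "'i \<Rightarrow> cspace"
  shows "apply_bcontfun (\<Sum>i\<in>I. f i) t = (\<Sum>i\<in>I. apply_bcontfun (f i) t)"
  by (induction I rule: infinite_finite_induct) auto

text \<open>Order and metric on \<open>seg\<close> are separate instances; they are linked through
  the preimage of a real interval.\<close>

lemma closed_atLeastAtMost_seg: "closed {a..b::seg}"
proof -
  have "{a..b} = real_of_seg -` {real_of_seg a..real_of_seg b}"
    by (auto simp: less_eq_seg_def)
  then show ?thesis
    using continuous_on_real_of_seg by (simp add: continuous_closed_vimage continuous_on_eq_continuous_at)
qed

text \<open>Intermediate value theorem, applied to the function transported to a real interval by
  \<open>seg_of_real\<close>.\<close>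

lemma bcontfun_sgn_eq_if_nonzero:
  fixes w :: cspace
  assumes "s \<le> t" and nz: "\<And>p. s \<le> p \<Longrightarrow> p \<le> t \<Longrightarrow> w p \<noteq> 0"
  shows "sgn (w s) = sgn (w t)"
proof (rule ccontr)
  assume ne: "sgn (w s) \<noteq> sgn (w t)"
  let ?f = "\<lambda>r. w (seg_of_real r)"
  let ?a = "real_of_seg s" and ?b = "real_of_seg t"
  have ab: "?a \<le> ?b" "?a \<ge> -1" "?b \<le> 1"
    using assms(1) real_of_seg[of s] real_of_seg[of t] by (auto simp: less_eq_seg_def)
  have cont: "continuous_on {?a..?b} ?f"
    by (rule continuous_on_subset[of "{-1..1}"])
      (use ab continuous_on_apply_bcontfun continuous_on_seg_iff in auto)
  have fab: "?f ?a = w s" "?f ?b = w t"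
    by (simp_all add: real_of_seg_inverse)
  have "\<exists>r. ?a \<le> r \<and> r \<le> ?b \<and> ?f r = 0"
  proof (cases "w s < 0")
    case True
    then have "w t \<ge> 0" using ne by (auto simp: sgn_real_def split: if_splits)
    then show ?thesis using IVT'[of ?f ?a 0 ?b] True cont ab fab by auto
  next
    case False
    then have "w t \<le> 0" "w s \<ge> 0" using ne nz[of s] assms(1) by (auto simp: sgn_real_def split: if_splits)
    then show ?thesis using IVT2'[of ?f ?b 0 ?a] cont ab fab by auto
  qed
  then obtain r where r: "?a \<le> r" "r \<le> ?b" "?f r = 0" by blast
  have "real_of_seg (seg_of_real r) = r"
    using r ab by (auto intro: seg_of_real_inverse)
  then show False using nz[of "seg_of_real r"] r by (auto simp: less_eq_seg_def)
qed

section \<open>Interpolation in a Chebyshev space\<close>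

text \<open>Strict monotonicity leaves out the indices 0 and \<open>m + 1\<close>: as
  \<open>x 1\<close> may be -1 and \<open>x m\<close> may be 1, the first and the last gap may be
  empty.\<close>

locale chebyshev_nodes =
  fixes m n :: nat and V :: "cspace set" and v :: "nat \<Rightarrow> cspace" and x :: "nat \<Rightarrow> seg"
  assumes n_le_m: "n \<le> m" and n_ge_3: "3 \<le> n"
    and chebyshev: "chebyshev_space n V"
    and const_in: "const_bcontfun c \<in> V"
    and inj_basis: "inj_on v {1..n}" and independent_basis: "independent (v ` {1..n})"
    and span_basis: "span (v ` {1..n}) = V"
    and nodes_mono: "strict_mono_on {1..m} x"
    and x_0: "x 0 = bot" and x_Suc_m: "x (m + 1) = top"
begin

definition node_set :: "nat set \<Rightarrow> bool" where
  "node_set S \<longleftrightarrow> S \<subseteq> {1..m} \<and> card S = n"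

lemma subspace_V: "subspace V"
  using chebyshev by (simp add: chebyshev_space_def)

lemma node_set_finite: "node_set S \<Longrightarrow> finite S"
  unfolding node_set_def by (metis finite_atLeastAtMost finite_subset)

lemma node_set_mem: "node_set S \<Longrightarrow> i \<in> S \<Longrightarrow> i \<in> {1..m}"
  by (auto simp: node_set_def)

lemma inj_nodes: "inj_on x {1..m}"
  using nodes_mono by (rule strict_mono_on_imp_inj_on)

lemma x_less_iff: "i \<in> {1..m} \<Longrightarrow> j \<in> {1..m} \<Longrightarrow> x i < x j \<longleftrightarrow> i < j"
  using nodes_mono by (rule strict_mono_on_less)

lemma x_eq_iff: "i \<in> {1..m} \<Longrightarrow> j \<in> {1..m} \<Longrightarrow> x i = x j \<longleftrightarrow> i = j"
  using inj_nodes by (rule inj_on_eq_iff)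

text \<open>Frees the Chebyshev condition from enumerations of the points by \<open>{1..n}\<close>,
  so that it can be used for arbitrary sets of nodes and auxiliary points.\<close>

lemma interpolation_unique:
  fixes \<gamma> :: "seg \<Rightarrow> real"
  assumes "finite P" "card P = n"
  shows "\<exists>!w. w \<in> V \<and> (\<forall>p\<in>P. apply_bcontfun w p = \<gamma> p)"
proof -
  obtain h where h: "bij_betw h {1..n} P"
    using ex_bij_betw_nat_finite_1[OF assms(1)] assms(2) by auto
  have "\<exists>!w. w \<in> V \<and> (\<forall>i\<in>{1..n}. apply_bcontfun w (h i) = (\<gamma> \<circ> h) i)"
    using chebyshev h unfolding chebyshev_space_def bij_betw_def by blast
  moreover have "(\<forall>i\<in>{1..n}. apply_bcontfun w (h i) = (\<gamma> \<circ> h) i) \<longleftrightarrow>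
      (\<forall>p\<in>P. apply_bcontfun w p = \<gamma> p)" for w
    using h by (auto simp: bij_betw_def)
  ultimately show ?thesis by simp
qed

lemma eq_if_eq_on_nodes:
  assumes "node_set S" "u \<in> V" "w \<in> V" "\<And>i. i \<in> S \<Longrightarrow> apply_bcontfun u (x i) = apply_bcontfun w (x i)"
  shows "u = w"
proof -
  have "card (x ` S) = n" "finite (x ` S)"
    using assms(1) inj_nodes by (auto simp: node_set_def card_image inj_on_subset node_set_finite[OF assms(1)])
  from interpolation_unique[OF this(2,1), of "apply_bcontfun w"] show ?thesis
    using assms by blast
qed

text \<open>The Haar condition, by comparison with the zero interpolant. All later sign arguments
  count zeros with it.\<close>

lemma eq_zero_if_many_zeros:
  assumes "finite P" "card P = n" "w \<in> V" "\<And>p. p \<in> P \<Longrightarrow> apply_bcontfun w p = 0"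
  shows "w = 0"
proof -
  have "0 \<in> V" by (rule subspace_0[OF subspace_V])
  then show ?thesis
    using interpolation_unique[OF assms(1,2), of "\<lambda>_. 0"] assms(3,4)
    by (metis zero_bcontfun.rep_eq)
qed

text \<open>The Lagrange functions of \<open>V\<close> for the nodes in \<open>S\<close>. If
  \<open>S\<close> is a node set and \<open>i\<close> is outside \<open>S\<close>, the conditions
  give the zero function, so the basic facts need no restriction on \<open>i\<close>.\<close>

definition lag :: "nat set \<Rightarrow> nat \<Rightarrow> cspace" where
  "lag S i = (THE w. w \<in> V \<and> (\<forall>i'\<in>S. apply_bcontfun w (x i') = (if i' = i then 1 else 0)))"

context
  fixes S
  assumes S: "node_set S"
begin

lemma lag_props: "lag S i \<in> V \<and> (\<forall>i'\<in>S. apply_bcontfun (lag S i) (x i') = (if i' = i then 1 else 0))"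
proof -
  have card: "card (x ` S) = n" "finite (x ` S)"
    using S inj_nodes by (auto simp: node_set_def card_image inj_on_subset node_set_finite[OF S])
  have inj: "inj_on x S" using S inj_nodes by (auto simp: node_set_def inj_on_subset)
  have "\<exists>!w. w \<in> V \<and> (\<forall>p\<in>x ` S. apply_bcontfun w p = (if the_inv_into S x p = i then 1 else 0))"
    by (rule interpolation_unique[OF card(2,1)])
  then have "\<exists>!w. w \<in> V \<and> (\<forall>i'\<in>S. apply_bcontfun w (x i') = (if i' = i then 1 else 0))"
    using inj by (simp add: the_inv_into_f_f)
  then show ?thesis unfolding lag_def by (rule theI')
qed

lemma lag_in: "lag S i \<in> V"
  using lag_props by blast

lemma lag_at_node: "i' \<in> S \<Longrightarrow> apply_bcontfun (lag S i) (x i') = (if i' = i then 1 else 0)"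
  using lag_props by blast

lemma lag_combination_in: "(\<Sum>i\<in>S. c i *\<^sub>R lag S i) \<in> V"
  by (intro subspace_sum subspace_scale subspace_V lag_in)

lemma lag_combination_at_node:
  assumes "j \<in> S"
  shows "apply_bcontfun (\<Sum>i\<in>S. c i *\<^sub>R lag S i) (x j) = c j"
proof -
  have "apply_bcontfun (\<Sum>i\<in>S. c i *\<^sub>R lag S i) (x j) = (\<Sum>i\<in>S. if j = i then c i else 0)"
    unfolding sum_bcontfun_apply by (rule sum.cong) (auto simp: lag_at_node assms)
  then show ?thesis using assms node_set_finite[OF S] by simp
qed

lemma lag_expansion: "w \<in> V \<Longrightarrow> w = (\<Sum>i\<in>S. apply_bcontfun w (x i) *\<^sub>R lag S i)"
  by (rule eq_if_eq_on_nodes[OF S]) (auto simp: lag_combination_at_node intro: lag_combination_in)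

lemma lag_expansion_apply:
  fixes w :: cspace
  assumes "w \<in> V"
  shows "w t = (\<Sum>i\<in>S. w (x i) * lag S i t)"
  by (subst lag_expansion[OF assms]) (simp add: sum_bcontfun_apply)

text \<open>The expansion of the constant 1. Once some value is negative, it makes the sum of the
  absolute values exceed 1.\<close>

lemma sum_lag: "(\<Sum>i\<in>S. apply_bcontfun (lag S i) t) = 1"
  using lag_expansion_apply[OF const_in[of 1], of t] by simp

text \<open>A zero at \<open>t\<close>, together with those at the other \<open>n - 1\<close> nodes
  of \<open>S\<close>, would give \<open>n\<close> zeros and contradict the value 1 at node
  \<open>i\<close>.\<close>

lemma lag_nonzero:
  assumes "i \<in> S" "t \<notin> x ` (S - {i})"
  shows "apply_bcontfun (lag S i) t \<noteq> 0"
proof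
  assume 0: "apply_bcontfun (lag S i) t = 0"
  have fin: "finite (x ` (S - {i}))" using node_set_finite[OF S] by auto
  have "card (x ` (S - {i})) = n - 1"
    using S inj_nodes assms(1) by (subst card_image) (auto simp: node_set_def intro: inj_on_subset)
  then have "card (insert t (x ` (S - {i}))) = n"
    using assms(2) fin n_ge_3 by simp
  moreover have "apply_bcontfun (lag S i) p = 0" if "p \<in> insert t (x ` (S - {i}))" for p
    using that 0 by (auto simp: lag_at_node split: if_splits)
  ultimately have "lag S i = 0"
    using fin lag_in by (intro eq_zero_if_many_zeros[of "insert t (x ` (S - {i}))"]) auto
  with lag_at_node[OF assms(1), of i] show False by simp
qed

text \<open>Take \<open>g\<close> in \<open>V\<close> with value 1 at \<open>x i\<close> that
  vanishes at \<open>t\<close> and at the nodes of \<open>S\<close> other than \<open>i\<close> and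
  \<open>j\<close>. These \<open>n - 1\<close> zeros leave none for the interval from
  \<open>x i\<close> to \<open>x j\<close>, so \<open>g (x j)\<close> is positive, and the expansion
  of \<open>g\<close> at \<open>t\<close> becomes a vanishing positive combination of the two
  Lagrange values.\<close>

lemma lag_opposite_signs:
  assumes ij: "i \<in> S" "j \<in> S" "i < j" and gap: "\<And>k. k \<in> S \<Longrightarrow> \<not> (i < k \<and> k < j)"
    and t: "t \<notin> x ` S" "\<not> (x i \<le> t \<and> t \<le> x j)"
  shows "apply_bcontfun (lag S i) t * apply_bcontfun (lag S j) t < 0"
proof -
  let ?P = "insert t (x ` (S - {i,j}))"
  have fin: "finite ?P" using node_set_finite[OF S] by auto
  have Sm: "S \<subseteq> {1..m}" using S by (simp add: node_set_def)
  have "card (S - {i,j}) = n - 2"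
    using S ij node_set_finite[OF S] by (subst card_Diff_subset) (auto simp: node_set_def)
  then have "card (x ` (S - {i,j})) = n - 2"
    using Sm inj_nodes by (subst card_image) (auto intro: inj_on_subset)
  then have cardP: "card ?P = n - 1"
    using t(1) fin n_ge_3 by (subst card_insert_disjoint) auto
  have xi: "x i \<notin> ?P"
    using t(1) ij Sm x_eq_iff[of i] by (auto simp: subset_iff)
  have cardQ: "card (insert (x i) ?P) = n"
    using cardP xi fin n_ge_3 by (subst card_insert_disjoint) auto
  obtain g where g: "g \<in> V"
    "\<forall>p\<in>insert (x i) ?P. apply_bcontfun g p = (if p = x i then 1 else 0)"
    using ex1_implies_ex[OF interpolation_unique[OF _ cardQ, of "\<lambda>p. if p = x i then 1 else 0"]]
      fin by blast
  have g_i: "g (x i) = 1"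
    using g(2) by simp
  have g_P: "g p = 0" if "p \<in> ?P" for p
  proof -
    have "p \<noteq> x i" using that xi by blast
    then show ?thesis using bspec[OF g(2), of p] that by simp
  qed
  \<comment> \<open>Such a \<open>p\<close> would be a new, \<open>n\<close>-th zero:
    \<open>t\<close> lies outside the interval, and no node of \<open>S\<close> lies strictly
    between \<open>i\<close> and \<open>j\<close>.\<close>
  have nz: "apply_bcontfun g p \<noteq> 0" if p: "x i \<le> p" "p \<le> x j" for p
  proof
    assume 0: "apply_bcontfun g p = 0"
    have "p \<notin> ?P"
    proof
      assume "p \<in> ?P"
      then consider "p = t" | k where "k \<in> S" "k \<noteq> i" "k \<noteq> j" "p = x k" by auto
      then show False
      proof cases
        case 2
        have mem: "i \<in> {1..m}" "j \<in> {1..m}" "k \<in> {1..m}"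
          using ij 2(1) Sm by blast+
        have "\<not> x k < x i" "\<not> x j < x k"
          using p unfolding 2(4) by (simp_all add: not_less)
        then have "\<not> k < i" "\<not> j < k"
          using x_less_iff[OF mem(3,1)] x_less_iff[OF mem(2,3)] by simp_all
        then show False using gap[OF 2(1)] 2(2,3) by linarith
      next
        case 1
        then show False using p t(2) by blast
      qed
    qed
    then have "card (insert p ?P) = n"
      using cardP fin n_ge_3 by (subst card_insert_disjoint) auto
    then have "g = 0"
      using fin g(1) 0 g_P by (intro eq_zero_if_many_zeros[of "insert p ?P"]) auto
    with g_i show False by simp
  qed
  have mem: "i \<in> {1..m}" "j \<in> {1..m}"
    using ij Sm by blast+
  then have "x i < x j" using ij(3) x_less_iff[OF mem] by simp
  then have "sgn (g (x i)) = sgn (g (x j))"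
    using nz by (intro bcontfun_sgn_eq_if_nonzero) auto
  then have gj: "g (x j) > 0" using g_i by (simp add: sgn_real_def split: if_splits)
  \<comment> \<open>Only the terms for \<open>i\<close> and \<open>j\<close> survive in the
    expansion of \<open>g\<close> at its zero \<open>t\<close>.\<close>
  have "0 = (\<Sum>k\<in>S. g (x k) * lag S k t)"
    using lag_expansion_apply[OF g(1), of t] g_P[of t] by simp
  also have "\<dots> = (\<Sum>k\<in>{i,j}. g (x k) * lag S k t)"
    using ij g_P by (intro sum.mono_neutral_right node_set_finite[OF S]) auto
  also have "\<dots> = lag S i t + g (x j) * lag S j t"
    using ij g_i by simp
  finally have "lag S i t = - (g (x j) * lag S j t)" by linarith
  then have eq: "lag S i t * lag S j t = - (g (x j) * (lag S j t)\<^sup>2)"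
    by (simp add: power2_eq_square)
  have "lag S j t \<noteq> 0" using lag_nonzero[OF ij(2), of t] t(1) by auto
  then show ?thesis unfolding eq using gj by simp
qed

text \<open>As \<open>n\<close> is at least 3, two nodes of \<open>S\<close> lie on the same side of
  \<open>t\<close>; the two closest to \<open>t\<close> on that side are neighbours in
  \<open>S\<close> and have Lagrange values of opposite signs at \<open>t\<close>.\<close>

lemma ex_lag_negative:
  assumes t: "t \<notin> x ` S"
  shows "\<exists>i\<in>S. apply_bcontfun (lag S i) t < 0"
proof -
  define L where "L = {i \<in> S. x i < t}"
  define R where "R = {i \<in> S. t < x i}"
  have sub: "L \<subseteq> S" "R \<subseteq> S" by (auto simp: L_def R_def)
  then have fin: "finite L" "finite R" using node_set_finite[OF S] by (meson finite_subset)+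
  have Sm: "S \<subseteq> {1..m}" using S by (simp add: node_set_def)
  have "x i < t \<or> t < x i" if "i \<in> S" for i
    using t that by (metis imageI linorder_neqE)
  then have "L \<union> R = S" by (auto simp: L_def R_def)
  moreover have "L \<inter> R = {}" by (auto simp: L_def R_def)
  ultimately have "card L + card R = n"
    using fin S card_Un_disjoint[of L R] by (simp add: node_set_def)
  with n_ge_3 have "card L \<ge> 2 \<or> card R \<ge> 2" by linarith
  then obtain i j where ij: "i \<in> S" "j \<in> S" "i < j" "\<And>k. k \<in> S \<Longrightarrow> \<not> (i < k \<and> k < j)"
    "\<not> (x i \<le> t \<and> t \<le> x j)"
  proof
    assume L2: "card L \<ge> 2"
    then have "L \<noteq> {}" by auto
    define j where "j = Max L"
    have j: "j \<in> L" "\<And>k. k \<in> L \<Longrightarrow> k \<le> j" using fin \<open>L \<noteq> {}\<close> unfolding j_def by simp_all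
    have "card (L - {j}) \<ge> 1" using L2 j fin by simp
    then have "L - {j} \<noteq> {}" by fastforce
    define i where "i = Max (L - {j})"
    have i: "i \<in> L - {j}" "\<And>k. k \<in> L - {j} \<Longrightarrow> k \<le> i"
      using fin Max_in[of "L - {j}"] Max_ge[of "L - {j}"] \<open>L - {j} \<noteq> {}\<close> unfolding i_def by blast+
    have "k \<in> L" if "k \<in> S" "k < j" for k
      using that j x_less_iff[of k j] Sm by (auto simp: L_def subset_iff)
    then have "\<not> (i < k \<and> k < j)" if "k \<in> S" for k
      using i(2)[of k] that by auto
    moreover have "i \<in> S" "j \<in> S" "i < j" "\<not> t \<le> x j"
      using i j(1) j(2)[of i] by (auto simp: L_def)
    ultimately show ?thesis using that by blast
  next
    assume R2: "card R \<ge> 2"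
    then have "R \<noteq> {}" by auto
    define i where "i = Min R"
    have i: "i \<in> R" "\<And>k. k \<in> R \<Longrightarrow> i \<le> k" using fin \<open>R \<noteq> {}\<close> unfolding i_def by simp_all
    have "card (R - {i}) \<ge> 1" using R2 i fin by simp
    then have "R - {i} \<noteq> {}" by fastforce
    define j where "j = Min (R - {i})"
    have j: "j \<in> R - {i}" "\<And>k. k \<in> R - {i} \<Longrightarrow> j \<le> k"
      using fin Min_in[of "R - {i}"] Min_le[of "R - {i}"] \<open>R - {i} \<noteq> {}\<close> unfolding j_def by blast+
    have "k \<in> R" if "k \<in> S" "i < k" for k
      using that i x_less_iff[of i k] Sm by (auto simp: R_def subset_iff)
    then have "\<not> (i < k \<and> k < j)" if "k \<in> S" for k
      using j(2)[of k] that by auto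
    moreover have "i \<in> S" "j \<in> S" "i < j" "\<not> x i \<le> t"
      using j i(1) i(2)[of j] by (auto simp: R_def)
    ultimately show ?thesis using that by blast
  qed
  from lag_opposite_signs[OF ij(1-4) t ij(5)] ij(1,2) show ?thesis
    by (auto simp: mult_less_0_iff)
qed

end

section \<open>Basic solutions of the minimization problem\<close>

lemma basis_expansion:
  assumes "w \<in> V"
  obtains c where "w = (\<Sum>j=1..n. c j *\<^sub>R v j)"
proof -
  obtain f where "w = (\<Sum>u\<in>v ` {1..n}. f u *\<^sub>R u)"
    using assms unfolding span_basis[symmetric] by (subst (asm) span_finite) auto
  also have "\<dots> = (\<Sum>j=1..n. f (v j) *\<^sub>R v j)"
    unfolding sum.reindex[OF inj_basis] by simp
  finally show ?thesis by (rule that)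
qed

lemma basis_coefficients_unique:
  assumes eq: "(\<Sum>j=1..n. c j *\<^sub>R v j) = (\<Sum>j=1..n. d j *\<^sub>R v j)" and k: "k \<in> {1..n}"
  shows "c k = d k"
proof -
  define f where "f u = c (the_inv_into {1..n} v u) - d (the_inv_into {1..n} v u)" for u
  have f: "f (v j) = c j - d j" if "j \<in> {1..n}" for j
    unfolding f_def the_inv_into_f_f[OF inj_basis that] ..
  have "(\<Sum>u\<in>v ` {1..n}. f u *\<^sub>R u) = (\<Sum>j=1..n. (c j - d j) *\<^sub>R v j)"
    unfolding sum.reindex[OF inj_basis] by (rule sum.cong) (simp_all add: f)
  also have "\<dots> = 0"
    using eq by (simp add: scaleR_left_diff_distrib sum_subtractf)
  finally have "f (v k) = 0"
    using independentD[OF independent_basis, of "v ` {1..n}" f "v k"] k by simp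
  then show ?thesis using f[OF k] by simp
qed

lemma basis_in: "j \<in> {1..n} \<Longrightarrow> v j \<in> V"
  using span_base[of "v j" "v ` {1..n}"] span_basis by simp

text \<open>The basis-free form of the constraint, by linearity. It allows any feasible vector to be
  tested against an arbitrary element of \<open>V\<close>, in particular against a
  certificate.\<close>

lemma l1_feasible_iff:
  "l1_feasible m n (colloc v x) (\<lambda>j. apply_bcontfun (v j) t) a \<longleftrightarrow>
    (\<forall>w\<in>V. (\<Sum>i=1..m. apply_bcontfun w (x i) * a i) = apply_bcontfun w t)"
proof
  assume *: "l1_feasible m n (colloc v x) (\<lambda>j. apply_bcontfun (v j) t) a"
  show "\<forall>w\<in>V. (\<Sum>i=1..m. apply_bcontfun w (x i) * a i) = apply_bcontfun w t"
  proof
    fix w assume "w \<in> V"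
    then obtain c where w: "w = (\<Sum>j=1..n. c j *\<^sub>R v j)" by (rule basis_expansion)
    have "(\<Sum>i=1..m. w (x i) * a i) = (\<Sum>i=1..m. \<Sum>j=1..n. c j * (v j (x i) * a i))"
      by (simp add: w sum_bcontfun_apply sum_distrib_right mult.assoc)
    also have "\<dots> = (\<Sum>j=1..n. \<Sum>i=1..m. c j * (v j (x i) * a i))"
      by (rule sum.swap)
    also have "\<dots> = (\<Sum>j=1..n. c j * (\<Sum>i=1..m. v j (x i) * a i))"
      by (simp add: sum_distrib_left)
    also have "\<dots> = (\<Sum>j=1..n. c j * v j t)"
      using * by (intro sum.cong) (auto simp: l1_feasible_def colloc_def)
    also have "\<dots> = w t" by (simp add: w sum_bcontfun_apply)
    finally show "(\<Sum>i=1..m. w (x i) * a i) = w t" .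
  qed
qed (auto simp: l1_feasible_def colloc_def basis_in)

context
  fixes S
  assumes S: "node_set S"
begin

text \<open>The rows of the inverse submatrix are the coordinates of the Lagrange functions in the
  basis \<open>v\<close>: one product is their values at the nodes, the other is the Lagrange
  expansion of the basis functions.\<close>

lemma coeff_vec_eq_lag: "coeff_vec n v x S t i = (if i \<in> S then apply_bcontfun (lag S i) t else 0)"
proof -
  let ?M = "colloc v x"
  let ?inverse = "\<lambda>N.
     (\<forall>j\<in>{1..n}. \<forall>j'\<in>{1..n}. (\<Sum>i\<in>S. ?M j i * N i j') = (if j = j' then 1 else 0)) \<and>
     (\<forall>i\<in>S. \<forall>i'\<in>S. (\<Sum>j=1..n. N i j * ?M j i') = (if i = i' then 1 else 0)) \<and>
     (\<forall>i j. i \<notin> S \<or> j \<notin> {1..n} \<longrightarrow> N i j = 0)"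
  have finS: "finite S" using S by (rule node_set_finite)
  have "\<exists>c. lag S i = (\<Sum>j=1..n. c j *\<^sub>R v j)" for i
    using lag_in[OF S] by (rule basis_expansion) blast
  then obtain c where c: "\<And>i. lag S i = (\<Sum>j=1..n. c i j *\<^sub>R v j)"
    by metis
  define N where "N i j = (if i \<in> S \<and> j \<in> {1..n} then c i j else 0)" for i j
  have lag_N: "lag S i = (\<Sum>j=1..n. N i j *\<^sub>R v j)" if "i \<in> S" for i
    unfolding c by (rule sum.cong) (use that in \<open>auto simp: N_def\<close>)
  have left: "(\<Sum>j=1..n. N i j * ?M j i') = (if i = i' then 1 else 0)" if "i \<in> S" "i' \<in> S" for i i'
    using lag_at_node[OF S that(2), of i]
    by (auto simp: lag_N[OF that(1)] sum_bcontfun_apply colloc_def)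
  have right: "(\<Sum>i\<in>S. ?M j i * N i j') = (if j = j' then 1 else 0)"
    if j: "j \<in> {1..n}" "j' \<in> {1..n}" for j j'
  \<comment> \<open>Both sides are the coordinates of \<open>v j\<close>, once through its Lagrange
    expansion and once trivially.\<close>
  proof (rule basis_coefficients_unique[OF _ j(2)])
    have "(\<Sum>j'=1..n. (\<Sum>i\<in>S. ?M j i * N i j') *\<^sub>R v j') = (\<Sum>i\<in>S. \<Sum>j'=1..n. (?M j i * N i j') *\<^sub>R v j')"
      unfolding scaleR_sum_left by (rule sum.swap)
    also have "\<dots> = (\<Sum>i\<in>S. ?M j i *\<^sub>R lag S i)"
      by (simp add: lag_N scaleR_sum_right)
    also have "\<dots> = v j"
      using lag_expansion[OF S basis_in[OF j(1)]] by (simp add: colloc_def)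
    also have "\<dots> = (\<Sum>j'=1..n. (if j' = j then v j' else 0))"
      using j(1) by simp
    also have "\<dots> = (\<Sum>j'=1..n. (if j = j' then 1 else 0) *\<^sub>R v j')"
      by (rule sum.cong) auto
    finally show "(\<Sum>j'=1..n. (\<Sum>i\<in>S. ?M j i * N i j') *\<^sub>R v j') =
        (\<Sum>j'=1..n. (if j = j' then 1 else 0) *\<^sub>R v j')" .
  qed
  have N: "?inverse N" using left right by (simp add: N_def)
  \<comment> \<open>The usual argument N' = N' (M N) = (N' M) N = N on the index range; outside it
    both vanish by the last conjunct.\<close>
  have unique: "N' = N" if N': "?inverse N'" for N'
  proof (intro ext)
    fix i j
    show "N' i j = N i j"
    proof (cases "i \<in> S \<and> j \<in> {1..n}")
      case True
      have "N' i j = (\<Sum>j'=1..n. if j' = j then N' i j' else 0)"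
        using True by simp
      also have "\<dots> = (\<Sum>j'=1..n. N' i j' * (\<Sum>i'\<in>S. ?M j' i' * N i' j))"
        by (rule sum.cong) (use True right in auto)
      also have "\<dots> = (\<Sum>j'=1..n. \<Sum>i'\<in>S. N' i j' * ?M j' i' * N i' j)"
        by (simp add: sum_distrib_left mult.assoc)
      also have "\<dots> = (\<Sum>i'\<in>S. \<Sum>j'=1..n. N' i j' * ?M j' i' * N i' j)"
        by (rule sum.swap)
      also have "\<dots> = (\<Sum>i'\<in>S. (\<Sum>j'=1..n. N' i j' * ?M j' i') * N i' j)"
        by (simp add: sum_distrib_right)
      also have "\<dots> = (\<Sum>i'\<in>S. if i' = i then N i' j else 0)"
        by (rule sum.cong) (use True N' in auto)
      also have "\<dots> = N i j" using True finS by simp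
      finally show ?thesis .
    next
      case False
      have "N' i j = 0" using N' False by blast
      then show ?thesis using False by (auto simp: N_def)
    qed
  qed
  have "sub_inverse n ?M S = N"
    unfolding sub_inverse_def by (rule the_equality) (fact N, rule unique)
  then show ?thesis
    by (auto simp: coeff_vec_def lag_N sum_bcontfun_apply)
qed

lemma sum_coeff_vec:
  "(\<Sum>i=1..m. f i * coeff_vec n v x S t i) = (\<Sum>i\<in>S. f i * apply_bcontfun (lag S i) t)"
  using S by (intro sum.mono_neutral_cong_right) (auto simp: coeff_vec_eq_lag node_set_def)

lemma sum_abs_coeff_vec:
  "(\<Sum>i=1..m. \<bar>coeff_vec n v x S t i\<bar>) = (\<Sum>i\<in>S. \<bar>apply_bcontfun (lag S i) t\<bar>)"
  using S by (intro sum.mono_neutral_cong_right) (auto simp: coeff_vec_eq_lag node_set_def)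

lemma coeff_vec_feasible:
  "l1_feasible m n (colloc v x) (\<lambda>j. apply_bcontfun (v j) t) (coeff_vec n v x S t)"
  unfolding l1_feasible_iff sum_coeff_vec using lag_expansion_apply[OF S] by simp

end

section \<open>Dual certificates and optimality of basic solutions\<close>

text \<open>
  The dual certificate of the basic solution on \<open>S\<close>.
\<close>

definition cert :: "nat set \<Rightarrow> seg \<Rightarrow> cspace" where
  "cert S t = (\<Sum>i\<in>S. sgn (apply_bcontfun (lag S i) t) *\<^sub>R lag S i)"

lemma cert_in: "node_set S \<Longrightarrow> cert S t \<in> V"
  unfolding cert_def by (rule lag_combination_in)

lemma cert_at_node: "node_set S \<Longrightarrow> j \<in> S \<Longrightarrow> cert S t (x j) = sgn (apply_bcontfun (lag S j) t)"
  unfolding cert_def by (rule lag_combination_at_node)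

lemma cert_apply: "cert S t s = (\<Sum>i\<in>S. sgn (apply_bcontfun (lag S i) t) * lag S i s)"
  by (simp add: cert_def sum_bcontfun_apply)

lemma cert_self: "cert S t t = (\<Sum>i\<in>S. \<bar>apply_bcontfun (lag S i) t\<bar>)"
  by (simp add: cert_apply abs_sgn mult.commute)

text \<open>
  One step of the simplex method: increase the absolute value of the entry \<open>j\<close> until the first
  entry in \<open>S\<close> vanishes. There is no degeneracy, as the entries in \<open>S\<close> are nonzero.
\<close>

lemma pivot_improves:
  assumes S: "node_set S" and t: "t \<notin> x ` {1..m}" and j: "j \<in> {1..m}"
    and viol: "1 < \<bar>apply_bcontfun (cert S t) (x j)\<bar>"
  obtains S' where "node_set S'"
    "(\<Sum>i\<in>S'. \<bar>apply_bcontfun (lag S' i) t\<bar>) < (\<Sum>i\<in>S. \<bar>apply_bcontfun (lag S i) t\<bar>)"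
proof -
  define a where "a i = lag S i t" for i
  define l where "l i = lag S i (x j)" for i
  \<comment> \<open>Entry \<open>j\<close> will become \<open>u * \<tau>\<close>, while each entry
    \<open>a i\<close> moves to \<open>a i - u * \<tau> * l i\<close>. Then \<open>d i\<close> is
    the rate at which the absolute value of entry \<open>i\<close> decreases.\<close>
  define \<tau> where "\<tau> = sgn (cert S t (x j))"
  define d where "d i = sgn (a i) * \<tau> * l i" for i
  have finS: "finite S" using S by (rule node_set_finite)
  have tS: "t \<notin> x ` S" using t S by (auto simp: node_set_def)
  have a: "a i \<noteq> 0" if "i \<in> S" for i
    using lag_nonzero[OF S that, of t] tS by (auto simp: a_def)
  have "\<bar>\<tau>\<bar> = 1" using viol by (auto simp: \<tau>_def sgn_real_def)
  have "j \<notin> S"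
    using viol cert_at_node[OF S, of j t] by (auto simp: sgn_real_def split: if_splits)
  \<comment> \<open>The total rate of decrease on \<open>S\<close> is the violated bound, hence
    larger than the rate 1 at which entry \<open>j\<close> grows.\<close>
  have sum_d: "(\<Sum>i\<in>S. d i) = \<bar>cert S t (x j)\<bar>"
  proof -
    have "(\<Sum>i\<in>S. d i) = \<tau> * (\<Sum>i\<in>S. sgn (a i) * l i)"
      by (simp add: d_def sum_distrib_left mult_ac)
    also have "\<dots> = \<tau> * cert S t (x j)" by (simp add: cert_apply a_def l_def)
    finally show ?thesis by (simp add: \<tau>_def abs_sgn mult.commute)
  qed
  define P where "P = {i \<in> S. 0 < d i}"
  have "P \<noteq> {}"
  proof
    assume "P = {}"
    then have "(\<Sum>i\<in>S. d i) \<le> 0" by (intro sum_nonpos) (auto simp: P_def not_less)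
    then show False using sum_d viol by simp
  qed
  have finP: "finite P" using finS by (auto simp: P_def)
  \<comment> \<open>Ratio test: the largest step during which no entry in \<open>S\<close> changes
    sign; \<open>i0\<close> is an entry that reaches 0.\<close>
  define u where "u = Min ((\<lambda>i. \<bar>a i\<bar> / d i) ` P)"
  have "u \<in> (\<lambda>i. \<bar>a i\<bar> / d i) ` P"
    unfolding u_def using finP \<open>P \<noteq> {}\<close> by (intro Min_in) auto
  then obtain i0 where i0: "i0 \<in> S" "0 < d i0" "u = \<bar>a i0\<bar> / d i0"
    by (auto simp: P_def)
  have "u > 0" using i0 a[OF i0(1)] by simp
  have u_le: "u * d i \<le> \<bar>a i\<bar>" if "i \<in> S" for i
  proof (cases "0 < d i")
    case True
    then have "u \<le> \<bar>a i\<bar> / d i"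
      unfolding u_def using finP that by (intro Min_le) (auto simp: P_def)
    then show ?thesis using True by (simp add: pos_le_divide_eq)
  next
    case False
    then have "u * d i \<le> 0" using \<open>u > 0\<close> by (simp add: mult_nonneg_nonpos)
    then show ?thesis by simp
  qed
  define b where "b i = a i - u * \<tau> * l i" for i
  have abs_b: "\<bar>b i\<bar> = \<bar>a i\<bar> - u * d i" if "i \<in> S" for i
  proof -
    have "sgn (a i) * b i = \<bar>a i\<bar> - u * d i"
      by (simp add: b_def d_def abs_sgn algebra_simps)
    moreover have "\<bar>b i\<bar> = \<bar>sgn (a i) * b i\<bar>"
      using a[OF that] by (simp add: abs_mult abs_sgn_eq)
    ultimately show ?thesis using u_le[OF that] by simp
  qed
  have b0: "b i0 = 0" using abs_b[OF i0(1)] i0 by simp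
  define S' where "S' = insert j (S - {i0})"
  have S': "node_set S'"
  proof -
    have "card S' = Suc (card S - 1)"
      using \<open>j \<notin> S\<close> i0(1) finS by (simp add: S'_def)
    then show ?thesis
      using S j n_ge_3 by (auto simp: node_set_def S'_def)
  qed
  \<comment> \<open>The moved vector still reproduces evaluation at \<open>t\<close>. Being
    supported on \<open>S'\<close>, it must consist of the Lagrange values of \<open>S'\<close>, as
    testing with \<open>lag S' k\<close> shows.\<close>
  have rep: "w t = (\<Sum>i\<in>S - {i0}. w (x i) * b i) + w (x j) * (u * \<tau>)" if "w \<in> V" for w :: cspace
  proof -
    have "w t = (\<Sum>i\<in>S. w (x i) * a i)"
      unfolding a_def by (rule lag_expansion_apply[OF S that])
    also have "\<dots> = (\<Sum>i\<in>S. w (x i) * b i + w (x i) * l i * (u * \<tau>))"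
      by (rule sum.cong) (auto simp: b_def algebra_simps)
    also have "\<dots> = (\<Sum>i\<in>S. w (x i) * b i) + (\<Sum>i\<in>S. w (x i) * l i) * (u * \<tau>)"
      by (simp add: sum.distrib sum_distrib_right)
    also have "(\<Sum>i\<in>S. w (x i) * l i) = w (x j)"
      unfolding l_def by (rule lag_expansion_apply[OF S that, symmetric])
    also have "(\<Sum>i\<in>S. w (x i) * b i) = (\<Sum>i\<in>S - {i0}. w (x i) * b i)"
      using b0 i0(1) finS by (subst sum.remove) auto
    finally show ?thesis .
  qed
  have mem: "j \<in> S'" "\<And>i. i \<in> S - {i0} \<Longrightarrow> i \<in> S'"
    by (auto simp: S'_def)
  have lag_k: "lag S' k t = b k" if k: "k \<in> S - {i0}" for k
  proof -
    have "lag S' k t = (\<Sum>i\<in>S - {i0}. lag S' k (x i) * b i) + lag S' k (x j) * (u * \<tau>)"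
      by (rule rep[OF lag_in[OF S']])
    also have "lag S' k (x j) = 0"
      using lag_at_node[OF S' mem(1), of k] k \<open>j \<notin> S\<close> by auto
    also have "(\<Sum>i\<in>S - {i0}. lag S' k (x i) * b i) = (\<Sum>i\<in>S - {i0}. if i = k then b i else 0)"
      by (rule sum.cong) (simp_all add: lag_at_node[OF S' mem(2)])
    also have "\<dots> = b k" using k finS by simp
    finally show ?thesis by simp
  qed
  have lag_j: "lag S' j t = u * \<tau>"
  proof -
    have "lag S' j t = (\<Sum>i\<in>S - {i0}. lag S' j (x i) * b i) + lag S' j (x j) * (u * \<tau>)"
      by (rule rep[OF lag_in[OF S']])
    also have "lag S' j (x j) = 1"
      using lag_at_node[OF S' mem(1), of j] by simp
    also have "(\<Sum>i\<in>S - {i0}. lag S' j (x i) * b i) = 0"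
      using \<open>j \<notin> S\<close> by (intro sum.neutral) (auto simp: lag_at_node[OF S' mem(2)])
    finally show ?thesis by simp
  qed
  have "(\<Sum>i\<in>S'. \<bar>lag S' i t\<bar>) = \<bar>u * \<tau>\<bar> + (\<Sum>i\<in>S - {i0}. \<bar>b i\<bar>)"
    using \<open>j \<notin> S\<close> finS lag_k lag_j by (simp add: S'_def)
  also have "(\<Sum>i\<in>S - {i0}. \<bar>b i\<bar>) = (\<Sum>i\<in>S. \<bar>b i\<bar>)"
    using b0 i0(1) finS by (subst (2) sum.remove) auto
  also have "\<dots> = (\<Sum>i\<in>S. \<bar>a i\<bar>) - u * \<bar>cert S t (x j)\<bar>"
    by (simp add: abs_b sum_subtractf sum_d[symmetric] sum_distrib_left)
  also have "\<bar>u * \<tau>\<bar> = u" using \<open>u > 0\<close> \<open>\<bar>\<tau>\<bar> = 1\<close> by (simp add: abs_mult)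
  also have "u + ((\<Sum>i\<in>S. \<bar>a i\<bar>) - u * \<bar>cert S t (x j)\<bar>) < (\<Sum>i\<in>S. \<bar>a i\<bar>)"
    using mult_strict_left_mono[OF viol \<open>u > 0\<close>] by simp
  finally have "(\<Sum>i\<in>S'. \<bar>lag S' i t\<bar>) < (\<Sum>i\<in>S. \<bar>lag S i t\<bar>)" by (simp add: a_def)
  with S' show ?thesis by (rule that)
qed

text \<open>Linear programming duality. A violated bound allows an improving pivot, which needs
  \<open>t\<close> off the nodes; conversely, the bounds make the certificate prove optimality. The
  criterion depends on \<open>t\<close> only through signs.\<close>

lemma admissible_set_iff:
  assumes t: "t \<notin> x ` {1..m}"
  shows "admissible_set m n v x t S \<longleftrightarrow>
    node_set S \<and> (\<forall>j\<in>{1..m}. \<bar>apply_bcontfun (cert S t) (x j)\<bar> \<le> 1)"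
proof (intro iffI conjI)
  assume adm: "admissible_set m n v x t S"
  then show S: "node_set S" by (simp add: admissible_set_def node_set_def)
  show "\<forall>j\<in>{1..m}. \<bar>apply_bcontfun (cert S t) (x j)\<bar> \<le> 1"
  proof (rule ccontr)
    assume "\<not> (\<forall>j\<in>{1..m}. \<bar>apply_bcontfun (cert S t) (x j)\<bar> \<le> 1)"
    then obtain j where j: "j \<in> {1..m}" "1 < \<bar>apply_bcontfun (cert S t) (x j)\<bar>"
      by (auto simp: not_le)
    obtain S' where S': "node_set S'"
      "(\<Sum>i\<in>S'. \<bar>apply_bcontfun (lag S' i) t\<bar>) < (\<Sum>i\<in>S. \<bar>apply_bcontfun (lag S i) t\<bar>)"
      using pivot_improves[OF S t j] by blast
    have "(\<Sum>i=1..m. \<bar>coeff_vec n v x S t i\<bar>) \<le> (\<Sum>i=1..m. \<bar>coeff_vec n v x S' t i\<bar>)"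
      using adm coeff_vec_feasible[OF S'(1)] by (auto simp: admissible_set_def l1_solution_def)
    then show False using S'(2) unfolding sum_abs_coeff_vec[OF S] sum_abs_coeff_vec[OF S'(1)] by simp
  qed
next
  assume *: "node_set S \<and> (\<forall>j\<in>{1..m}. \<bar>apply_bcontfun (cert S t) (x j)\<bar> \<le> 1)"
  then have S: "node_set S" by blast
  have "(\<Sum>i=1..m. \<bar>coeff_vec n v x S t i\<bar>) \<le> (\<Sum>i=1..m. \<bar>a i\<bar>)"
    if a: "l1_feasible m n (colloc v x) (\<lambda>j. apply_bcontfun (v j) t) a" for a
  proof -
    \<comment> \<open>Weak duality: every feasible \<open>a\<close> reproduces the value of the
      certificate at \<open>t\<close>.\<close>
    have "(\<Sum>i=1..m. \<bar>coeff_vec n v x S t i\<bar>) = cert S t t"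
      unfolding sum_abs_coeff_vec[OF S] cert_self ..
    also have "\<dots> = (\<Sum>i=1..m. cert S t (x i) * a i)"
      using a cert_in[OF S] unfolding l1_feasible_iff by simp
    also have "\<dots> \<le> (\<Sum>i=1..m. \<bar>a i\<bar>)"
    proof (rule sum_mono)
      fix i assume "i \<in> {1..m}"
      then have "\<bar>cert S t (x i)\<bar> * \<bar>a i\<bar> \<le> 1 * \<bar>a i\<bar>"
        using * by (intro mult_right_mono) auto
      then show "cert S t (x i) * a i \<le> \<bar>a i\<bar>"
        using abs_ge_self[of "cert S t (x i) * a i"] by (simp add: abs_mult)
    qed
    finally show ?thesis .
  qed
  then show "admissible_set m n v x t S"
    using S coeff_vec_feasible[OF S] by (simp add: admissible_set_def l1_solution_def node_set_def)
qed

text \<open>There are finitely many node sets, so one has the least l1 norm; no pivot can improve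
  it, hence it satisfies the dual bounds and is optimal among all feasible vectors.\<close>

lemma ex_admissible_set:
  assumes t: "t \<notin> x ` {1..m}"
  shows "\<exists>S. admissible_set m n v x t S"
proof -
  define norm1 where "norm1 S = (\<Sum>i\<in>S. \<bar>apply_bcontfun (lag S i) t\<bar>)" for S
  have fin: "finite {S. node_set S}"
    by (rule finite_subset[of _ "Pow {1..m}"]) (auto simp: node_set_def)
  have "node_set {1..n}" using n_le_m by (simp add: node_set_def)
  then have ne: "{S. node_set S} \<noteq> {}" by blast
  define S where "S = arg_min_on norm1 {S. node_set S}"
  have S: "node_set S" "\<And>S'. node_set S' \<Longrightarrow> norm1 S \<le> norm1 S'"
    using arg_min_if_finite(1)[OF fin ne, of norm1] arg_min_least[OF fin ne, of _ norm1]
    by (simp_all add: S_def)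
  have "\<bar>apply_bcontfun (cert S t) (x j)\<bar> \<le> 1" if j: "j \<in> {1..m}" for j
  proof (rule ccontr)
    assume "\<not> \<bar>apply_bcontfun (cert S t) (x j)\<bar> \<le> 1"
    then obtain S' where "node_set S'" "norm1 S' < norm1 S"
      using pivot_improves[OF S(1) t j] by (auto simp: norm1_def not_le)
    then show False using S(2)[of S'] by simp
  qed
  then show ?thesis using S(1) admissible_set_iff[OF t] by blast
qed

section \<open>Passing between points of the same gap\<close>

text \<open>By \<open>lag_nonzero\<close> a Lagrange function can change sign only at nodes of
  \<open>S\<close>.\<close>

lemma lag_sgn_eq:
  assumes S: "node_set S" and i: "i \<in> S"
    and no_node: "\<And>k. k \<in> S \<Longrightarrow> \<not> (min s t \<le> x k \<and> x k \<le> max s t)"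
  shows "sgn (apply_bcontfun (lag S i) s) = sgn (apply_bcontfun (lag S i) t)"
proof -
  have nz: "apply_bcontfun (lag S i) p \<noteq> 0" if "min s t \<le> p" "p \<le> max s t" for p
    using no_node that by (intro lag_nonzero[OF S i]) blast
  show ?thesis
  proof (cases "s \<le> t")
    case True
    with nz show ?thesis by (intro bcontfun_sgn_eq_if_nonzero) auto
  next
    case False
    with nz have "sgn (apply_bcontfun (lag S i) t) = sgn (apply_bcontfun (lag S i) s)"
      by (intro bcontfun_sgn_eq_if_nonzero) auto
    then show ?thesis by simp
  qed
qed

text \<open>
  If a node \<open>j\<close> next to \<open>t\<close> were missing from \<open>S\<close>, the sums defining the certificate at \<open>x j\<close>
  would have the sign pattern of \<open>t\<close>, so the certificate would be the l1 norm of a vector of sum 1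
  with a negative entry.
\<close>

lemma neighbour_in_admissible_set:
  assumes t: "t \<notin> x ` {1..m}" and adm: "admissible_set m n v x t S" and j: "j \<in> {1..m}"
    and no_node: "\<And>k. k \<in> {1..m} \<Longrightarrow> \<not> (t < x k \<and> x k < x j) \<and> \<not> (x j < x k \<and> x k < t)"
  shows "j \<in> S"
proof (rule ccontr)
  assume "j \<notin> S"
  have S: "node_set S" and le1: "\<bar>apply_bcontfun (cert S t) (x j)\<bar> \<le> 1"
    using adm admissible_set_iff[OF t] j by auto
  \<comment> \<open>As \<open>j\<close> is missing from \<open>S\<close> and is next to
    \<open>t\<close>, this closed interval contains no node of \<open>S\<close>; hence Lagrange
    signs at \<open>t\<close> and \<open>x j\<close> agree.\<close>
  have between: "\<not> (min t (x j) \<le> x k \<and> x k \<le> max t (x j))" if k: "k \<in> S" for k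
  proof -
    have km: "k \<in> {1..m}" using node_set_mem[OF S k] .
    have "x k \<noteq> x j" using x_eq_iff[OF km j] k \<open>j \<notin> S\<close> by auto
    moreover have "x k \<noteq> t" using t km by auto
    ultimately show ?thesis using no_node[OF km] by (auto simp: min_def max_def split: if_splits)
  qed
  have "x j \<notin> x ` S"
  proof
    assume "x j \<in> x ` S"
    then obtain k where "k \<in> S" "x j = x k" by auto
    then show False using x_eq_iff[OF j node_set_mem[OF S]] \<open>j \<notin> S\<close> by auto
  qed
  then obtain i0 where i0: "i0 \<in> S" "apply_bcontfun (lag S i0) (x j) < 0"
    using ex_lag_negative[OF S] by blast
  have "1 = (\<Sum>i\<in>S. apply_bcontfun (lag S i) (x j))" using sum_lag[OF S] by simp
  also have "\<dots> < (\<Sum>i\<in>S. \<bar>apply_bcontfun (lag S i) (x j)\<bar>)"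
    by (rule sum_strict_mono_ex1) (use i0 node_set_finite[OF S] in force)+
  also have "\<dots> = (\<Sum>i\<in>S. sgn (apply_bcontfun (lag S i) (x j)) * apply_bcontfun (lag S i) (x j))"
    by (simp add: abs_sgn mult.commute)
  also have "\<dots> = cert S t (x j)"
    unfolding cert_apply
    by (intro sum.cong refl) (simp add: lag_sgn_eq[OF S _ between])
  finally show False using le1 by simp
qed

text \<open>The signs of the Lagrange values agree at \<open>s\<close> and \<open>t\<close>, so both
  points have the same certificate.\<close>

lemma admissible_set_transfer:
  assumes s: "s \<notin> x ` {1..m}" and t: "t \<notin> x ` {1..m}"
    and no_node: "\<And>k. k \<in> {1..m} \<Longrightarrow> \<not> (min s t \<le> x k \<and> x k \<le> max s t)"
    and adm: "admissible_set m n v x s S"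
  shows "admissible_set m n v x t S"
proof -
  have S: "node_set S" using adm admissible_set_iff[OF s] by blast
  have "cert S s = cert S t"
    unfolding cert_def
    by (intro sum.cong refl) (simp add: lag_sgn_eq[OF S _ no_node[OF node_set_mem[OF S]]])
  then show ?thesis using adm admissible_set_iff[OF s] admissible_set_iff[OF t] by simp
qed

section \<open>Position of nodes and points relative to the gaps\<close>

lemma x_mono:
  assumes "i \<le> j" "j \<le> m + 1"
  shows "x i \<le> x j"
proof -
  consider "i = 0" | "j = m + 1" | "i \<in> {1..m}" "j \<in> {1..m}"
    using assms by fastforce
  then show ?thesis
  proof cases
    case 3
    then show ?thesis using assms(1) x_less_iff[OF 3(2,1)] by (simp add: not_less[symmetric])
  qed (use x_0 x_Suc_m in auto)
qed

lemma node_in_gap_closure: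
  assumes k: "k \<in> gaps m x" and i: "i \<in> {1..m}" and "x (k - 1) \<le> x i" "x i \<le> x k"
  shows "i = k - 1 \<or> i = k"
proof (rule ccontr)
  assume "\<not> (i = k - 1 \<or> i = k)"
  then consider "i < k - 1" | "k < i" by linarith
  then show False
  proof cases
    case 1
    then have "k - 1 \<in> {1..m}" using k by (auto simp: gaps_def)
    then show False using x_less_iff[OF i] 1 assms(3) by (simp add: not_less[symmetric])
  next
    case 2
    then have "k \<in> {1..m}" using k i by (auto simp: gaps_def)
    then show False using x_less_iff[OF _ i] 2 assms(4) by (simp add: not_less[symmetric])
  qed
qed

text \<open>The last index \<open>k\<close> with \<open>x k\<close> at most \<open>t\<close> starts
  a suitable gap, unless \<open>t\<close> is 1, where the last nonempty gap is taken.\<close>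

lemma in_gap_closure:
  obtains k where "k \<in> gaps m x" "x (k - 1) \<le> t" "t \<le> x k"
proof (cases "t = top")
  case False
  then have "t < top" by (simp add: top.not_eq_extremum)
  define A where "A = {k \<in> {0..m}. x k \<le> t}"
  have "0 \<in> A" by (simp add: A_def x_0)
  moreover have "finite A" by (simp add: A_def)
  ultimately have max: "Max A \<in> A" "\<And>k. k \<in> A \<Longrightarrow> k \<le> Max A"
    by (auto intro: Max_in)
  have "t < x (Suc (Max A))"
  proof (cases "Max A = m")
    case True
    then show ?thesis using \<open>t < top\<close> x_Suc_m by simp
  next
    case False
    then have "Suc (Max A) \<in> {0..m}" using max(1) by (auto simp: A_def)
    moreover have "Suc (Max A) \<notin> A" using max(2)[of "Suc (Max A)"] by auto
    ultimately show ?thesis by (auto simp: A_def not_le)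
  qed
  moreover have "x (Max A) \<le> t" "Max A \<le> m" using max(1) by (auto simp: A_def)
  ultimately show ?thesis by (intro that[of "Suc (Max A)"]) (auto simp: gaps_def)
next
  case True
  show ?thesis
  proof (cases "x m = top")
    case False
    then have "m + 1 \<in> gaps m x" using x_Suc_m by (simp add: gaps_def top.not_eq_extremum)
    with True show ?thesis using x_Suc_m by (intro that[of "m + 1"]) auto
  next
    \<comment> \<open>Gap \<open>m + 1\<close> is empty here; gap \<open>m\<close> is nonempty
      because \<open>m - 1\<close> is still a node index.\<close>
    case xm: True
    have "m - 1 \<in> {1..m}" "m \<in> {1..m}" using n_le_m n_ge_3 by auto
    then have "x (m - 1) < x m" using x_less_iff[of "m - 1" m] by auto
    then have "m \<in> gaps m x" using n_le_m n_ge_3 by (simp add: gaps_def)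
    with True xm show ?thesis by (intro that[of m]) auto
  qed
qed

text \<open>Distinct closed gaps meet at most in common endpoints, and an endpoint that is not a
  node can only be -1 in gap 1 or 1 in gap \<open>m + 1\<close>.\<close>

lemma gap_index_eq:
  assumes t: "t \<notin> x ` {1..m}" and k: "k \<in> gaps m x" "x (k - 1) \<le> t" "t \<le> x k"
  shows "gap_index m x t = k"
  unfolding gap_index_def
proof (rule the_equality)
  have km: "1 \<le> k" "k \<le> m + 1" using k(1) by (auto simp: gaps_def)
  have left: "k = 1 \<and> t = bot" if "t = x (k - 1)"
  proof -
    have "k - 1 \<notin> {1..m}" using t that by auto
    then have "k = 1" using km by auto
    then show ?thesis using that x_0 by simp
  qed
  have right: "k = m + 1 \<and> t = top" if "t = x k"
  proof -
    have "k \<notin> {1..m}" using t that by auto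
    then have "k = m + 1" using km by auto
    then show ?thesis using that x_Suc_m by simp
  qed
  show "k \<in> gaps m x \<and> (t \<in> {x (k - 1)<..<x k} \<or> k = 1 \<and> t = bot \<or> k = m + 1 \<and> t = top)"
    using k left right by (auto simp: less_le)
  fix k' assume k': "k' \<in> gaps m x \<and>
    (t \<in> {x (k' - 1)<..<x k'} \<or> k' = 1 \<and> t = bot \<or> k' = m + 1 \<and> t = top)"
  have km': "1 \<le> k'" "k' \<le> m + 1" using k' by (auto simp: gaps_def)
  have t': "x (k' - 1) \<le> t" "t \<le> x k'" "x (k' - 1) < x k'"
    using k' x_0 x_Suc_m by (auto simp: gaps_def)
  show "k' = k"
  proof (rule ccontr)
    assume "k' \<noteq> k"
    then consider "k' \<le> k - 1" | "k \<le> k' - 1" by linarith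
    then show False
    proof cases
      case 1
      have "x k' \<le> x (k - 1)" using 1 km by (intro x_mono) auto
      then have "t = x k'" "t = x (k - 1)" using k(2) t'(2) by auto
      moreover from this left have "k = 1" by blast
      ultimately show False using 1 km' by simp
    next
      case 2
      have "x k \<le> x (k' - 1)" using 2 km' by (intro x_mono) auto
      then have "t = x k" using k(3) t'(1) by auto
      with right have "k = m + 1" by blast
      then show False using 2 km' by simp
    qed
  qed
qed

section \<open>The recovery map\<close>

context
  fixes z :: "nat \<Rightarrow> seg" and S :: "nat \<Rightarrow> nat set"
  assumes z: "\<And>k. k \<in> gaps m x \<Longrightarrow> z k \<in> {x (k - 1)<..<x k}"
begin

lemma z_not_node: "k \<in> gaps m x \<Longrightarrow> z k \<notin> x ` {1..m}"
proof
  assume k: "k \<in> gaps m x" and "z k \<in> x ` {1..m}"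
  then obtain i where i: "i \<in> {1..m}" "z k = x i" by auto
  then have "i = k - 1 \<or> i = k" using z[OF k] by (intro node_in_gap_closure[OF k]) auto
  then show False using z[OF k] i by auto
qed

context
  assumes adm: "\<And>k. k \<in> gaps m x \<Longrightarrow> admissible_set m n v x (z k) (S k)"
begin

lemma node_set_gap: "k \<in> gaps m x \<Longrightarrow> node_set (S k)"
  using adm admissible_set_iff[OF z_not_node] by blast

text \<open>Ensures that the Lagrange functions used on a gap already take the prescribed values 0
  and 1 at those endpoints of the gap that are nodes.\<close>

lemma gap_end_in_S:
  assumes k: "k \<in> gaps m x" and l: "l \<in> {1..m}" "l = k - 1 \<or> l = k"
  shows "l \<in> S k"
proof (rule neighbour_in_admissible_set[OF z_not_node[OF k] adm[OF k] l(1)])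
  fix i assume i: "i \<in> {1..m}"
  show "\<not> (z k < x i \<and> x i < x l) \<and> \<not> (x l < x i \<and> x i < z k)"
    using z[OF k] l(2) node_in_gap_closure[OF k i] by fastforce
qed

lemma admissible_set_in_gap:
  assumes t: "t \<notin> x ` {1..m}" and k: "k \<in> gaps m x" "x (k - 1) \<le> t" "t \<le> x k"
  shows "admissible_set m n v x t (S k)"
proof (rule admissible_set_transfer[OF z_not_node[OF k(1)] t _ adm[OF k(1)]])
  fix i assume i: "i \<in> {1..m}"
  show "\<not> (min (z k) t \<le> x i \<and> x i \<le> max (z k) t)"
  proof
    assume *: "min (z k) t \<le> x i \<and> x i \<le> max (z k) t"
    have "x (k - 1) \<le> min (z k) t" "max (z k) t \<le> x k" using z[OF k(1)] k by auto
    with * have "x (k - 1) \<le> x i" "x i \<le> x k" by (meson order_trans)+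
    then have "i = k - 1 \<or> i = k" by (rule node_in_gap_closure[OF k(1) i])
    moreover have "x i \<noteq> t" using t i by auto
    ultimately show False using * z[OF k(1)] k by (auto simp: min_def max_def split: if_splits)
  qed
qed

text \<open>One formula on the closed gap: at endpoints that are nodes, the separate definition of
  \<open>a_sharp\<close> agrees with it because these nodes belong to \<open>S k\<close>.\<close>

lemma a_sharp_on_gap:
  assumes k: "k \<in> gaps m x" "x (k - 1) \<le> t" "t \<le> x k" and i: "i \<in> {1..m}"
  shows "a_sharp m n v x S i t = (if i \<in> S k then apply_bcontfun (lag (S k) i) t else 0)"
proof (cases "t \<in> x ` {1..m}")
  case True
  then obtain l where l: "l \<in> {1..m}" "t = x l" by auto
  then have "l \<in> S k"
    using k by (intro gap_end_in_S node_in_gap_closure) auto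
  then show ?thesis
    using True l i by (auto simp: a_sharp_def lag_at_node[OF node_set_gap[OF k(1)]] x_eq_iff)
next
  case False
  then show ?thesis
    by (simp add: a_sharp_def gap_index_eq[OF False k] coeff_vec_eq_lag[OF node_set_gap[OF k(1)]])
qed

text \<open>Pasting: the finitely many closed gaps cover the segment, and on each of them the
  function is an element of \<open>V\<close> or zero.\<close>

lemma continuous_a_sharp:
  assumes i: "i \<in> {1..m}"
  shows "continuous_on UNIV (a_sharp m n v x S i)"
proof -
  have "continuous_on (\<Union>k\<in>gaps m x. {x (k - 1)..x k}) (a_sharp m n v x S i)"
  proof (rule continuous_on_closed_Union)
    show "finite (gaps m x)" by (simp add: gaps_def)
    fix k assume k: "k \<in> gaps m x"
    show "closed {x (k - 1)..x k}" by (rule closed_atLeastAtMost_seg)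
    have "continuous_on {x (k - 1)..x k} (\<lambda>t. if i \<in> S k then apply_bcontfun (lag (S k) i) t else 0)"
      by (cases "i \<in> S k") simp_all
    then show "continuous_on {x (k - 1)..x k} (a_sharp m n v x S i)"
      by (rule continuous_on_eq) (use a_sharp_on_gap[OF k _ _ i] in auto)
  qed
  moreover have "t \<in> (\<Union>k\<in>gaps m x. {x (k - 1)..x k})" for t
    by (rule in_gap_closure[of t]) auto
  then have "(\<Union>k\<in>gaps m x. {x (k - 1)..x k}) = UNIV" by blast
  ultimately show ?thesis by simp
qed

lemma recovery_map_apply:
  "recovery_map m n v x S y t = (\<Sum>i=1..m. y i * a_sharp m n v x S i t)"
proof -
  have "apply_bcontfun (Bcontfun (a_sharp m n v x S i)) = a_sharp m n v x S i" if "i \<in> {1..m}" for i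
    using continuous_a_sharp[OF that] by (simp add: Bcontfun_inverse bcontfun_seg_iff)
  then show ?thesis
    unfolding recovery_map_def sum_bcontfun_apply by (intro sum.cong) auto
qed

lemma recovery_map_at_node:
  assumes l: "l \<in> {1..m}"
  shows "recovery_map m n v x S y (x l) = y l"
proof -
  have "recovery_map m n v x S y (x l) = (\<Sum>i=1..m. if i = l then y i else 0)"
    unfolding recovery_map_apply using l
    by (intro sum.cong) (auto simp: a_sharp_def x_eq_iff)
  then show ?thesis using l by simp
qed

lemma recovery_map_in_gap:
  assumes k: "k \<in> gaps m x" "x (k - 1) \<le> t" "t \<le> x k"
  shows "recovery_map m n v x S y t = (\<Sum>i\<in>S k. y i * apply_bcontfun (lag (S k) i) t)"
proof -
  have "recovery_map m n v x S y t =
      (\<Sum>i=1..m. if i \<in> S k then y i * apply_bcontfun (lag (S k) i) t else 0)"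
    unfolding recovery_map_apply by (intro sum.cong refl) (simp add: a_sharp_on_gap[OF k])
  also have "\<dots> = (\<Sum>i\<in>{1..m} \<inter> S k. y i * apply_bcontfun (lag (S k) i) t)"
    by (simp add: sum.inter_restrict)
  also have "{1..m} \<inter> S k = S k" using node_set_gap[OF k(1)] by (auto simp: node_set_def)
  finally show ?thesis .
qed

end

end

section \<open>Optimality\<close>

text \<open>Two model functions with the same data force an error of at least half their distance.
  The value -1 of \<open>G\<close> at \<open>t\<close> contributes the summand 1 in addition to the
  l1 norm.\<close>

lemma wce_lower_bound:
  assumes t: "t \<notin> x ` {1..m}" and adm: "admissible_set m n v x t S" and "0 \<le> \<epsilon>"
  shows "ennreal (\<epsilon> * (1 + (\<Sum>i\<in>S. \<bar>apply_bcontfun (lag S i) t\<bar>))) \<le> wce m x (approx_model V \<epsilon>) \<Delta>"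
proof -
  let ?\<Lambda> = "\<Sum>i\<in>S. \<bar>apply_bcontfun (lag S i) t\<bar>"
  have S: "node_set S" and le1: "\<And>j. j \<in> {1..m} \<Longrightarrow> \<bar>apply_bcontfun (cert S t) (x j)\<bar> \<le> 1"
    using adm admissible_set_iff[OF t] by auto
  let ?X = "real_of_seg ` insert t (x ` {1..m})"
  \<comment> \<open>Values for the Tietze extension; admissibility bounds them by 1 at the nodes,
    and \<open>t\<close> is not a node, so they do not conflict.\<close>
  define \<gamma> where "\<gamma> r = (if r = real_of_seg t then -1 else apply_bcontfun (cert S t) (seg_of_real r))" for r
  have fin: "finite ?X" by simp
  have "continuous_on ?X \<gamma>" by (rule continuous_on_finite[OF fin])
  moreover have "closedin (top_of_set UNIV) ?X" using finite_imp_closed[OF fin] by simp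
  moreover have "norm (\<gamma> r) \<le> 1" if "r \<in> ?X" for r
    using that le1 by (auto simp: \<gamma>_def real_of_seg_inverse)
  ultimately obtain g where g: "continuous_on UNIV g" "\<And>r. r \<in> ?X \<Longrightarrow> g r = \<gamma> r" "\<And>r. norm (g r) \<le> 1"
    using Tietze[of ?X \<gamma> UNIV 1] by auto
  have "continuous_on UNIV (\<lambda>s. g (real_of_seg s))"
    by (rule continuous_on_compose2[OF g(1) continuous_on_real_of_seg]) simp
  then obtain G :: cspace where G: "apply_bcontfun G = (\<lambda>s. g (real_of_seg s))"
    using bcontfunE bcontfun_seg_iff by metis
  have G_t: "G t = -1" using g(2)[of "real_of_seg t"] by (simp add: G \<gamma>_def)
  have G_x: "G (x i) = cert S t (x i)" if "i \<in> {1..m}" for i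
  proof -
    have "x i \<noteq> t" using t that by auto
    then show ?thesis
      using g(2)[of "real_of_seg (x i)"] that
      by (simp add: G \<gamma>_def real_of_seg_inverse real_of_seg_inject)
  qed
  have "norm G \<le> 1" by (rule norm_bound) (simp add: G g(3)[unfolded real_norm_def])
  define h where "h = \<epsilon> *\<^sub>R (cert S t - G)"
  \<comment> \<open>Stated for both signs of \<open>c\<close>, so that it serves \<open>h\<close>
    and \<open>- h\<close>; the approximant from \<open>V\<close> is a multiple of the
    certificate.\<close>
  have model: "f \<in> approx_model V \<epsilon>" if "c *\<^sub>R cert S t - f = c *\<^sub>R G" "\<bar>c\<bar> = \<epsilon>" for f c
  proof -
    have "c *\<^sub>R cert S t \<in> V" by (intro subspace_scale subspace_V cert_in S)
    then have "infdist f V \<le> dist f (c *\<^sub>R cert S t)" by (rule infdist_le)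
    also have "\<dots> = norm (c *\<^sub>R G)" by (metis dist_commute dist_norm that(1))
    also have "\<dots> \<le> \<epsilon>"
      using \<open>norm G \<le> 1\<close> that(2) mult_left_mono[of "norm G" 1 "\<bar>c\<bar>"] by simp
    finally show ?thesis by (simp add: approx_model_def)
  qed
  have h_x: "h (x i) = 0" if "i \<in> {1..m}" for i
    using that by (simp add: h_def G_x)
  define d where "d = \<Delta> (\<lambda>i\<in>{1..m}. 0)"
  have le: "ennreal (norm (f - d)) \<le> wce m x (approx_model V \<epsilon>) \<Delta>"
    if "f \<in> approx_model V \<epsilon>" "\<And>i. i \<in> {1..m} \<Longrightarrow> apply_bcontfun f (x i) = 0" for f
  proof -
    have "(\<lambda>i\<in>{1..m}. apply_bcontfun f (x i)) = (\<lambda>i\<in>{1..m}. 0)"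
      by (intro restrict_ext that(2))
    then show ?thesis
      unfolding wce_def d_def by (intro SUP_upper2[OF that(1)]) simp
  qed
  have le_h: "ennreal (norm (h - d)) \<le> wce m x (approx_model V \<epsilon>) \<Delta>"
  proof (rule le)
    show "h \<in> approx_model V \<epsilon>"
      using \<open>0 \<le> \<epsilon>\<close> by (intro model[of \<epsilon>]) (simp_all add: h_def algebra_simps)
  qed (rule h_x)
  have le_minus_h: "ennreal (norm (- h - d)) \<le> wce m x (approx_model V \<epsilon>) \<Delta>"
  proof (rule le)
    show "- h \<in> approx_model V \<epsilon>"
      using \<open>0 \<le> \<epsilon>\<close> by (intro model[of "-\<epsilon>"]) (simp_all add: h_def algebra_simps)
  qed (use h_x in simp)
  have "\<epsilon> * (1 + ?\<Lambda>) = h t" by (simp add: h_def G_t cert_self algebra_simps)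
  also have "\<dots> \<le> norm h" using norm_bounded[of h t] by simp
  \<comment> \<open>Both \<open>h\<close> and \<open>- h\<close> are reconstructed as the same
    \<open>d\<close>, so the triangle inequality bounds the larger error from below.\<close>
  also have "\<dots> \<le> max (norm (h - d)) (norm (- h - d))"
  proof -
    have "2 * norm h = norm ((h - d) - (- h - d))"
      by (simp flip: scaleR_2)
    also have "\<dots> \<le> norm (h - d) + norm (- h - d)" by (rule norm_triangle_ineq4)
    finally show ?thesis by linarith
  qed
  finally have "ennreal (\<epsilon> * (1 + ?\<Lambda>)) \<le> ennreal (max (norm (h - d)) (norm (- h - d)))"
    by (rule ennreal_leI)
  also have "\<dots> \<le> wce m x (approx_model V \<epsilon>) \<Delta>"
    using le_h le_minus_h by (simp add: max_def)
  finally show ?thesis .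
qed

text \<open>Interpolation reproduces \<open>V\<close>, so \<open>f\<close> may be replaced by
  \<open>f - w\<close> for any \<open>w\<close> in \<open>V\<close>, whose values are bounded by the
  distance from \<open>f\<close> to \<open>w\<close>.\<close>

lemma lag_interpolation_error:
  assumes S: "node_set S" and f: "f \<in> approx_model V \<epsilon>"
  shows "\<bar>apply_bcontfun f t - (\<Sum>i\<in>S. apply_bcontfun f (x i) * apply_bcontfun (lag S i) t)\<bar>
    \<le> \<epsilon> * (1 + (\<Sum>i\<in>S. \<bar>apply_bcontfun (lag S i) t\<bar>))" (is "?err \<le> \<epsilon> * ?C")
proof -
  have C: "0 < ?C" by (simp add: add_pos_nonneg sum_nonneg)
  \<comment> \<open>Dividing by the positive constant allows passing to the infimum over
    \<open>w\<close> without a best approximant.\<close>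
  have "?err / ?C \<le> infdist f V"
  proof -
    have "?err / ?C \<le> dist f w" if "w \<in> V" for w
    proof -
      let ?r = "\<lambda>s. apply_bcontfun f s - apply_bcontfun w s"
      have r: "\<bar>?r s\<bar> \<le> dist f w" for s
        using dist_bounded[of f s w] by (simp add: dist_real_def)
      have "?err = \<bar>?r t - (\<Sum>i\<in>S. ?r (x i) * lag S i t)\<bar>"
        using lag_expansion_apply[OF S that, of t] by (simp add: left_diff_distrib sum_subtractf)
      also have "\<dots> \<le> \<bar>?r t\<bar> + \<bar>\<Sum>i\<in>S. ?r (x i) * lag S i t\<bar>" by (rule abs_triangle_ineq4)
      also have "\<bar>\<Sum>i\<in>S. ?r (x i) * lag S i t\<bar> \<le> (\<Sum>i\<in>S. \<bar>?r (x i) * lag S i t\<bar>)"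
        by (rule sum_abs)
      also have "\<dots> \<le> (\<Sum>i\<in>S. dist f w * \<bar>lag S i t\<bar>)"
        unfolding abs_mult by (intro sum_mono mult_right_mono r) simp
      finally have "?err \<le> dist f w * ?C"
        using r[of t] by (simp add: sum_distrib_left distrib_left)
      then show ?thesis using C by (simp add: pos_divide_le_eq)
    qed
    moreover have "V \<noteq> {}" using const_in by blast
    ultimately show ?thesis by (simp add: infdist_notempty cINF_greatest)
  qed
  also have "\<dots> \<le> \<epsilon>" using f by (simp add: approx_model_def)
  finally show ?thesis using C by (simp add: pos_divide_le_eq)
qed

text \<open>At nodes the recovery is exact. Elsewhere the interpolation error bound coincides with
  the lower bound valid for every map. An infinite error of the competing map is trivial.\<close>

lemma recovery_map_optimal:
  assumes z: "\<And>k. k \<in> gaps m x \<Longrightarrow> z k \<in> {x (k - 1)<..<x k}"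
    and adm: "\<And>k. k \<in> gaps m x \<Longrightarrow> admissible_set m n v x (z k) (S k)"
    and "0 \<le> \<epsilon>"
  shows "wce m x (approx_model V \<epsilon>) (recovery_map m n v x S) \<le> wce m x (approx_model V \<epsilon>) \<Delta>"
proof (cases "wce m x (approx_model V \<epsilon>) \<Delta>")
  case (real W)
  have "norm (f - recovery_map m n v x S (\<lambda>i\<in>{1..m}. apply_bcontfun f (x i))) \<le> W"
    (is "norm (f - ?R) \<le> W") if f: "f \<in> approx_model V \<epsilon>" for f
  proof (rule norm_bound)
    fix t
    show "norm (apply_bcontfun (f - ?R) t) \<le> W"
    proof (cases "t \<in> x ` {1..m}")
      case True
      then obtain l where l: "l \<in> {1..m}" "t = x l" by auto
      then have "?R t = f t" by (simp add: recovery_map_at_node[OF z adm])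
      then show ?thesis using real(1) by simp
    next
      case False
      obtain k where k: "k \<in> gaps m x" "x (k - 1) \<le> t" "t \<le> x k" by (rule in_gap_closure)
      have admt: "admissible_set m n v x t (S k)"
        by (rule admissible_set_in_gap[OF z adm False k])
      have Sk: "node_set (S k)" using admt admissible_set_iff[OF False] by blast
      have "?R t = (\<Sum>i\<in>S k. (\<lambda>i\<in>{1..m}. apply_bcontfun f (x i)) i * lag (S k) i t)"
        by (rule recovery_map_in_gap[OF z adm k])
      also have "\<dots> = (\<Sum>i\<in>S k. f (x i) * lag (S k) i t)"
        by (intro sum.cong refl) (auto dest: node_set_mem[OF Sk])
      finally have "?R t = (\<Sum>i\<in>S k. f (x i) * lag (S k) i t)" .
      then have "norm (apply_bcontfun (f - ?R) t)
          \<le> \<epsilon> * (1 + (\<Sum>i\<in>S k. \<bar>apply_bcontfun (lag (S k) i) t\<bar>))"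
        using lag_interpolation_error[OF Sk f, of t] by simp
      also have "ennreal \<dots> \<le> ennreal W"
        using wce_lower_bound[OF False admt \<open>0 \<le> \<epsilon>\<close>, of \<Delta>] real(2) by simp
      then have "\<epsilon> * (1 + (\<Sum>i\<in>S k. \<bar>apply_bcontfun (lag (S k) i) t\<bar>)) \<le> W"
        using real(1) by (simp add: ennreal_le_iff)
      finally show ?thesis .
    qed
  qed
  then show ?thesis
    unfolding real(2) unfolding wce_def by (intro SUP_least ennreal_leI)
qed simp

end

theorem mainTheorem1:
  fixes m n :: nat
    and V :: "cspace set"
    and v :: "nat \<Rightarrow> cspace"
    and x z :: "nat \<Rightarrow> seg"
  assumes "m \<ge> n" and "n \<ge> 3"
    and "chebyshev_space n V"
    and "\<forall>c. const_bcontfun c \<in> V"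
    and "inj_on v {1..n}" and "independent (v ` {1..n})" and "span (v ` {1..n}) = V"
    and "strict_mono_on {1..m} x"
    and "x 0 = bot" and "x (m + 1) = top"
    and "\<forall>k\<in>gaps m x. z k \<in> {x (k - 1)<..<x k}"
  shows "(\<forall>k\<in>gaps m x. \<exists>S. admissible_set m n v x (z k) S) \<and>
    (\<forall>S. (\<forall>k\<in>gaps m x. admissible_set m n v x (z k) (S k)) \<longrightarrow>
      (\<forall>i\<in>{1..m}. continuous_on UNIV (a_sharp m n v x S i)) \<and>
      (\<forall>c d y y'. recovery_map m n v x S (\<lambda>i. c * y i + d * y' i)
                   = c *\<^sub>R recovery_map m n v x S y + d *\<^sub>R recovery_map m n v x S y') \<and>
      (\<forall>\<epsilon>\<ge>0. \<forall>\<Delta>. wce m x (approx_model V \<epsilon>) (recovery_map m n v x S)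
                   \<le> wce m x (approx_model V \<epsilon>) \<Delta>))"
proof -
  interpret chebyshev_nodes m n V v x
    by unfold_locales (use assms in auto)
  have z: "z k \<in> {x (k - 1)<..<x k}" if "k \<in> gaps m x" for k
    using assms that by blast
  have linear: "recovery_map m n v x S (\<lambda>i. c * y i + d * y' i)
      = c *\<^sub>R recovery_map m n v x S y + d *\<^sub>R recovery_map m n v x S y'" for S c d y y'
    by (simp add: recovery_map_def scaleR_add_left sum.distrib scaleR_sum_right)
  show ?thesis
  proof (intro conjI allI impI ballI)
    show "\<exists>S. admissible_set m n v x (z k) S" if "k \<in> gaps m x" for k
      using z_not_node[OF z that] by (rule ex_admissible_set)
  next
    fix S assume "\<forall>k\<in>gaps m x. admissible_set m n v x (z k) (S k)"
    then have adm: "admissible_set m n v x (z k) (S k)" if "k \<in> gaps m x" for k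
      using that by blast
    show "continuous_on UNIV (a_sharp m n v x S i)" if "i \<in> {1..m}" for i
      by (rule continuous_a_sharp[OF z adm that])
    show "wce m x (approx_model V \<epsilon>) (recovery_map m n v x S) \<le> wce m x (approx_model V \<epsilon>) \<Delta>"
      if "0 \<le> \<epsilon>" for \<epsilon> \<Delta>
      by (rule recovery_map_optimal[OF z adm that])
  qed (rule linear)
qed

end
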